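(* Let $\underline a=\{a_n\}_{n=0}^\infty$ be a (strictly) increasing sequence of non-negative integers, and put $x_n=3^{-(a_n+1)}$ (viewed as an element of $\mathbb{T}=\mathbb{R}/\mathbb{Z}$) and $g_n=a_{n+1}-a_n$. The set $K_{\underline a,3}=\{0\}\cup\{\pm x_n\mid n\in\mathbb{N}\}$ is quasi-convex in $\mathbb{T}$ if and only if the following two conditions hold: (i) $a_0>0$; (ii) $g_n>1$ for all $n\in\mathbb{N}$.
   Context: $\mathbb{N}$ includes $0$. $\mathbb{T}=\mathbb{R}/\mathbb{Z}$ with canonical projection $\pi\colon\mathbb{R}\to\mathbb{T}$; real numbers are identified with their images in $\mathbb{T}$. Put $\mathbb{T}_+=\pi([-\frac14,\frac14])$. For an abelian topological group $G$, $\widehat G$ is the group of characters, i.e. continuous homomorphisms $G\to\mathbb{T}$. For $E\subseteq G$ and $A\subseteq\widehat G$ put $E^\triangleright=\{\chi\in\widehat G\mid\chi(E)\subseteq\mathbb{T}_+\}$ and $A^\triangleleft=\{x\in G\mid\chi(x)\in\mathbb{T}_+\text{ for all }\chi\in A\}$. The set $E$ is quasi-convex in $G$ if $E=E^{\triangleright\triangleleft}$; equivalently, for every $x\in G\setminus E$ there is $\chi\in E^\triangleright$ with $\chi(x)\notin\mathbb{T}_+$. *)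

theory Defs
  imports Complex_Main
begin

definition cong_Ints :: "real \<Rightarrow> real \<Rightarrow> bool" where
  "cong_Ints x y \<longleftrightarrow> x - y \<in> \<int>"

lemma equivp_cong_Ints: "equivp cong_Ints"
proof (rule equivpI)
  show "reflp cong_Ints"
    by (simp add: reflp_def cong_Ints_def)
  show "symp cong_Ints"
    unfolding symp_def cong_Ints_def using Ints_minus by fastforce
  show "transp cong_Ints"
    unfolding transp_def cong_Ints_def using Ints_add by fastforce
qed

text \<open>The torus \<open>\<real>/\<int>\<close>; \<open>circle_of\<close> is the canonical projection.\<close>

quotient_type circle = real / cong_Ints
  by (rule equivp_cong_Ints)

lift_definition circle_of :: "real \<Rightarrow> circle" is "\<lambda>x. x" .

lemma circle_of_eq_iff: "circle_of x = circle_of y \<longleftrightarrow> x - y \<in> \<int>"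
  by transfer (simp add: cong_Ints_def)

lemma circle_of_cases: obtains x where "z = circle_of x"
proof -
  have "\<exists>x. z = circle_of x"
  proof transfer
    show "\<exists>x. cong_Ints z x" for z
      by (rule exI[of _ z]) (simp add: cong_Ints_def)
  qed
  then show thesis using that by blast
qed

instantiation circle :: ab_group_add
begin

lift_definition zero_circle :: circle is 0 .

lift_definition plus_circle :: "circle \<Rightarrow> circle \<Rightarrow> circle" is "(+)"
  unfolding cong_Ints_def by (metis Ints_add add_diff_add)

lift_definition uminus_circle :: "circle \<Rightarrow> circle" is uminus
  unfolding cong_Ints_def by (metis Ints_minus minus_diff_minus)

lift_definition minus_circle :: "circle \<Rightarrow> circle \<Rightarrow> circle" is "(-)"
proof -
  fix a b c d :: real
  assume "cong_Ints a b" "cong_Ints c d"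
  then have "(a - b) - (c - d) \<in> \<int>"
    unfolding cong_Ints_def by (rule Ints_diff)
  then show "cong_Ints (a - c) (b - d)"
    unfolding cong_Ints_def by (simp add: algebra_simps)
qed

instance
  by standard (transfer; simp add: cong_Ints_def)+

end

lemma circle_of_0: "circle_of 0 = 0"
  by transfer (simp add: cong_Ints_def)

lemma circle_of_add: "circle_of (x + y) = circle_of x + circle_of y"
  by transfer (simp add: cong_Ints_def)

lemma circle_of_minus: "circle_of (- x) = - circle_of x"
  by transfer (simp add: cong_Ints_def)

instantiation circle :: topological_space
begin

definition open_circle :: "circle set \<Rightarrow> bool" where
  "open_circle U \<longleftrightarrow> open (circle_of -` U)"

instance
proof
  show "open (UNIV :: circle set)"
    by (simp add: open_circle_def)
  show "open (S \<inter> T)" if "open S" "open T" for S T :: "circle set"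
    using that by (simp add: open_circle_def open_Int)
  show "open (\<Union>K)" if "\<forall>S\<in>K. open S" for K :: "circle set set"
    using that by (auto simp: open_circle_def vimage_Union)
qed

end

lemma continuous_circle_of: "continuous_on UNIV circle_of"
  by (simp add: continuous_on_open_vimage open_circle_def)

lemma open_image_circle_of:
  assumes "open V"
  shows "open (circle_of ` V)"
proof -
  have "circle_of -` (circle_of ` V) = (\<Union>k\<in>\<int>. (\<lambda>x. x - k) -` V)"
  proof (intro set_eqI iffI)
    fix x assume "x \<in> circle_of -` (circle_of ` V)"
    then obtain v where "v \<in> V" "x - v \<in> \<int>"
      by (auto simp: circle_of_eq_iff)
    then show "x \<in> (\<Union>k\<in>\<int>. (\<lambda>x. x - k) -` V)"
      by (intro UN_I[of "x - v"]) auto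
  next
    fix x assume "x \<in> (\<Union>k\<in>\<int>. (\<lambda>x. x - k) -` V)"
    then obtain k where "k \<in> \<int>" "x - k \<in> V" by auto
    moreover have "circle_of x = circle_of (x - k)"
      using \<open>k \<in> \<int>\<close> by (simp add: circle_of_eq_iff)
    ultimately show "x \<in> circle_of -` (circle_of ` V)" by auto
  qed
  moreover have "open ((\<lambda>x. x - k) -` V)" for k
    using assms by (intro open_vimage continuous_intros)
  ultimately show ?thesis
    by (auto simp: open_circle_def intro: open_UN)
qed

lemma eventually_nhds_circle_of:
  "eventually P (nhds (circle_of x)) \<longleftrightarrow> eventually (\<lambda>t. P (circle_of t)) (nhds x)"
proof
  assume "eventually P (nhds (circle_of x))"
  then obtain S where "open S" "circle_of x \<in> S" "\<forall>z\<in>S. P z"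
    by (auto simp: eventually_nhds)
  then show "eventually (\<lambda>t. P (circle_of t)) (nhds x)"
    unfolding eventually_nhds open_circle_def by blast
next
  assume "eventually (\<lambda>t. P (circle_of t)) (nhds x)"
  then obtain V where "open V" "x \<in> V" "\<forall>t\<in>V. P (circle_of t)"
    by (auto simp: eventually_nhds)
  then show "eventually P (nhds (circle_of x))"
    unfolding eventually_nhds using open_image_circle_of by blast
qed

lemma nhds_circle_of: "nhds (circle_of x) = filtermap circle_of (nhds x)"
  by (rule filter_eqI) (simp add: eventually_nhds_circle_of eventually_filtermap)

instance circle :: topological_ab_group_add
proof
  fix a b :: circle
  obtain x y where xy: "a = circle_of x" "b = circle_of y"
    by (meson circle_of_cases)
  have "filterlim (\<lambda>p. circle_of (fst p + snd p)) (nhds (circle_of (x + y)))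
          (nhds x \<times>\<^sub>F nhds y)"
    by (rule filterlim_compose[OF _ tendsto_add_Pair])
       (simp add: filterlim_def nhds_circle_of)
  then show "filterlim (\<lambda>p. fst p + snd p) (nhds (a + b)) (nhds a \<times>\<^sub>F nhds b)"
    by (simp add: xy nhds_circle_of prod_filtermap1 prod_filtermap2 filterlim_filtermap
        circle_of_add[symmetric])
next
  fix a :: circle
  obtain x where x: "a = circle_of x"
    by (meson circle_of_cases)
  have "filterlim (\<lambda>t. circle_of (- t)) (nhds (circle_of (- x))) (nhds x)"
    by (rule filterlim_compose[OF _ tendsto_uminus_nhds])
       (simp add: filterlim_def nhds_circle_of)
  then show "filterlim uminus (nhds (- a)) (nhds a)"
    by (simp add: x nhds_circle_of filterlim_filtermap circle_of_minus)
qed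

definition circle_plus :: "circle set" where
  "circle_plus = circle_of ` {-(1/4)..1/4}"

definition characters :: "('a::topological_ab_group_add \<Rightarrow> circle) set" where
  "characters = {\<chi>. (\<forall>x y. \<chi> (x + y) = \<chi> x + \<chi> y) \<and> continuous_on UNIV \<chi>}"

definition polar :: "'a::topological_ab_group_add set \<Rightarrow> ('a \<Rightarrow> circle) set" where
  "polar E = {\<chi> \<in> characters. \<chi> ` E \<subseteq> circle_plus}"

definition prepolar :: "('a::topological_ab_group_add \<Rightarrow> circle) set \<Rightarrow> 'a set" where
  "prepolar A = {x. \<forall>\<chi>\<in>A. \<chi> x \<in> circle_plus}"

definition quasi_convex :: "'a::topological_ab_group_add set \<Rightarrow> bool" where
  "quasi_convex E \<longleftrightarrow> E = prepolar (polar E)"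

definition xseq :: "(nat \<Rightarrow> nat) \<Rightarrow> nat \<Rightarrow> circle" where
  "xseq a n = circle_of (1 / 3 ^ (a n + 1))"

text \<open>Integer subtraction avoids truncation.\<close>

definition gap :: "(nat \<Rightarrow> nat) \<Rightarrow> nat \<Rightarrow> int" where
  "gap a n = int (a (n + 1)) - int (a n)"

definition K3 :: "(nat \<Rightarrow> nat) \<Rightarrow> circle set" where
  "K3 a = {0} \<union> (range (xseq a) \<union> range (\<lambda>n. - xseq a n))"

end

theory Submission
  imports Defs
begin

text \<open>
  Necessity: if \<open>a 0 = 0\<close>, every character in the polar kills \<open>x\<^sub>0 = 1/3\<close>, so \<open>x\<^sub>0 + x\<^sub>1\<close> lies in the
  hull; if \<open>x\<^sub>n = 3 x\<^bsub>n+1\<^esub>\<close>, every character in the polar maps \<open>x\<^bsub>n+1\<^esub>\<close> into \<open>[-1/12, 1/12]\<close>, so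
  \<open>2 x\<^bsub>n+1\<^esub>\<close> lies in the hull.

  Sufficiency: multiplication by \<open>3\<^sup>j\<close> and by \<open>2 \<cdot> 3\<^sup>j\<close> is in the polar whenever \<open>j\<close> is not
  a value of \<open>a\<close>. Hence, for \<open>y\<close> in the hull, \<open>3\<^sup>j y\<close> is within \<open>1/8\<close> of an integer
  for these \<open>j\<close>, which says that the balanced ternary digits of \<open>y\<close> vanish off the values of \<open>a\<close>.
  Two nonzero digits \<open>e\<close>, \<open>f\<close> at places \<open>p < q\<close> are excluded by the polar element
  \<open>2 \<cdot> 3\<^bsup>p-1\<^esup> + 2 e f \<cdot> 3\<^bsup>q-1\<^esup>\<close>, which moves \<open>y\<close> to within \<open>1/18\<close> of \<open>\<plusminus>4/9\<close>.
\<close>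

section \<open>Distance to the integers, and characters of the circle\<close>

definition near_int :: "real \<Rightarrow> real \<Rightarrow> bool" where
  "near_int c y \<longleftrightarrow> (\<exists>m::int. \<bar>y - of_int m\<bar> \<le> c)"

lemma near_intI: "\<bar>y - of_int m\<bar> \<le> c \<Longrightarrow> near_int c y"
  by (auto simp: near_int_def)

lemma near_int_add_int: "near_int c (y + of_int k) \<longleftrightarrow> near_int c y"
proof -
  have *: "near_int c (y + of_int k)" if "near_int c y" for y and k :: int
  proof -
    from that obtain m :: int where "\<bar>y - of_int m\<bar> \<le> c" by (auto simp: near_int_def)
    then show ?thesis by (intro near_intI[of _ "m + k"]) simp
  qed
  from *[of y k] *[of "y + of_int k" "-k"] show ?thesis by auto
qed

lemma circle_of_mem_plus_iff: "circle_of y \<in> circle_plus \<longleftrightarrow> near_int (1/4) y"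
proof
  assume "circle_of y \<in> circle_plus"
  then obtain t where "t \<in> {-(1/4)..1/4}" and t2: "y - t \<in> \<int>"
    unfolding circle_plus_def by (auto simp: circle_of_eq_iff)
  then have t: "\<bar>t\<bar> \<le> 1/4" by auto
  from t2 obtain m :: int where "y - t = of_int m" by (rule Ints_cases)
  with t show "near_int (1/4) y" by (intro near_intI[of _ m]) linarith
next
  assume "near_int (1/4) y"
  then obtain m :: int where m: "\<bar>y - of_int m\<bar> \<le> 1/4" by (auto simp: near_int_def)
  then have "circle_of y = circle_of (y - of_int m)" by (simp add: circle_of_eq_iff)
  moreover have "y - of_int m \<in> {-(1/4)..1/4}" unfolding atLeastAtMost_iff using m by linarith
  ultimately show "circle_of y \<in> circle_plus" by (auto simp: circle_plus_def)
qed

lemma circle_plus_cases: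
  assumes "z \<in> circle_plus"
  obtains t where "z = circle_of t" "\<bar>t\<bar> \<le> 1/4"
  using assms by (force simp: circle_plus_def)

text \<open>Sufficiency separates points by these characters; necessity treats arbitrary characters
  through their additivity, as in \<open>character_power3\<close>.\<close>

lift_definition int_mult :: "int \<Rightarrow> circle \<Rightarrow> circle" is "\<lambda>k x. of_int k * x"
  unfolding cong_Ints_def by (metis Ints_mult Ints_of_int right_diff_distrib)

lemma int_mult_circle_of: "int_mult k (circle_of x) = circle_of (of_int k * x)"
  by transfer (simp add: cong_Ints_def)

lemma int_mult_character: "int_mult k \<in> characters"
proof -
  have "int_mult k (x + y) = int_mult k x + int_mult k y" for x y
    by transfer (simp add: cong_Ints_def algebra_simps)
  moreover have "continuous_on UNIV (int_mult k)"
  proof -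
    have "open (int_mult k -` U)" if "open U" for U
    proof -
      have "circle_of -` (int_mult k -` U) = (\<lambda>x. of_int k * x) -` (circle_of -` U)"
        by (auto simp: int_mult_circle_of)
      moreover have "open ((\<lambda>x::real. of_int k * x) -` (circle_of -` U))"
        using that[unfolded open_circle_def] by (rule open_vimage) (intro continuous_intros)
      ultimately show ?thesis by (simp add: open_circle_def)
    qed
    then show ?thesis by (simp only: continuous_on_open_vimage open_UNIV) simp
  qed
  ultimately show ?thesis by (simp add: characters_def)
qed

lemma subset_prepolar_polar: "E \<subseteq> prepolar (polar E)"
  by (auto simp: prepolar_def polar_def)

lemma character_zero: "\<chi> \<in> characters \<Longrightarrow> \<chi> 0 = 0"
  by (metis (mono_tags, lifting) characters_def mem_Collect_eq add_cancel_left_left add_0)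

lemma character_minus: "\<chi> \<in> characters \<Longrightarrow> \<chi> (- x) = - \<chi> x"
  using character_zero[of \<chi>]
  by (metis (mono_tags, lifting) characters_def mem_Collect_eq eq_neg_iff_add_eq_0 add.left_inverse)

lemma circle_plus_minus: "z \<in> circle_plus \<Longrightarrow> - z \<in> circle_plus"
  by (elim circle_plus_cases)
    (auto simp: circle_plus_def circle_of_minus[symmetric] intro!: imageI)

text \<open>Characters respect 0 and negation, and \<open>circle_plus\<close> is symmetric and
  contains 0, so only the points \<open>xseq a n\<close> need testing.\<close>

lemma polar_K3_iff:
  "\<chi> \<in> polar (K3 a) \<longleftrightarrow> \<chi> \<in> characters \<and> (\<forall>n. \<chi> (xseq a n) \<in> circle_plus)"
proof -
  have "(0::circle) \<in> circle_plus"
    using circle_of_mem_plus_iff[of 0] near_intI[of 0 0 "1/4"] by (simp add: circle_of_0)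
  then show ?thesis
    by (auto simp: polar_def K3_def character_zero character_minus circle_plus_minus)
qed

text \<open>This is how hull membership enters sufficiency: each multiplier k in the polar yields
  one inequality for a real representative y.\<close>

lemma prepolar_polar_K3_near_int:
  assumes "circle_of y \<in> prepolar (polar (K3 a))"
    and "\<And>n. near_int (1/4) (of_int k / 3 ^ (a n + 1))"
  shows "near_int (1/4) (of_int k * y)"
proof -
  have "int_mult k \<in> polar (K3 a)"
    using assms(2)
    by (simp add: polar_K3_iff int_mult_character xseq_def int_mult_circle_of circle_of_mem_plus_iff)
  with assms(1) show ?thesis
    by (auto simp: prepolar_def int_mult_circle_of circle_of_mem_plus_iff)
qed

text \<open>Tripling is a threefold sum, so additivity suffices. Enough triplings carry 1/3^c to 1,
  that is to 0 in the circle, which constrains its image.\<close>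

lemma character_power3:
  assumes "\<chi> \<in> characters" "\<chi> (circle_of s) = circle_of t"
  shows "\<chi> (circle_of (3 ^ j * s)) = circle_of (3 ^ j * t)"
proof (induction j)
  case 0
  then show ?case using assms by simp
next
  case (Suc j)
  have triple: "circle_of (3 ^ Suc j * u) =
      circle_of (3 ^ j * u) + circle_of (3 ^ j * u) + circle_of (3 ^ j * u)" for u
    by (simp add: circle_of_add[symmetric] algebra_simps)
  show ?case
    using assms(1) Suc unfolding triple by (simp add: characters_def)
qed

section \<open>Necessity of the two conditions\<close>

lemma circle_of_eq_0_iff: "circle_of x = 0 \<longleftrightarrow> x \<in> \<int>"
  using circle_of_eq_iff[of x 0] by (simp add: circle_of_0)

lemma mem_K3_iff:
  "circle_of y \<in> K3 a \<longleftrightarrow>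
    y \<in> \<int> \<or> (\<exists>n. y - 1 / 3 ^ (a n + 1) \<in> \<int> \<or> y + 1 / 3 ^ (a n + 1) \<in> \<int>)"
  by (auto simp: K3_def xseq_def circle_of_eq_0_iff circle_of_minus[symmetric] circle_of_eq_iff)

lemma not_Ints_between_0_1: "0 < x \<Longrightarrow> x < 1 \<Longrightarrow> x \<notin> \<int>" for x :: real
  using Ints_nonzero_abs_less1[of x] by auto

lemma two_mult_power3_neq: "2 * (3::real) ^ d \<noteq> 3 ^ c"
proof
  assume "2 * (3::real) ^ d = 3 ^ c"
  then have "real (2 * 3 ^ d) = real (3 ^ c)" by simp
  then have "2 * (3::nat) ^ d = 3 ^ c" by (rule of_nat_eq_iff[THEN iffD1])
  then have "even ((3::nat) ^ c)" by (metis even_mult_iff dvd_refl)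
  then show False by simp
qed

lemma inverse_power3_le: "c \<le> d \<Longrightarrow> 1 / (3::real) ^ d \<le> 1 / 3 ^ c"
  by (simp add: frac_le power_increasing)

lemma not_quasi_convex_if_start_0:
  assumes "strict_mono a" "a 0 = 0"
  shows "\<not> quasi_convex (K3 a)"
proof
  assume qc: "quasi_convex (K3 a)"
  define d where "d = 1 / (3::real) ^ (a 1 + 1)"
  have "a 1 \<ge> 1" using assms strict_monoD[of a 0 1] by simp
  then have d: "0 < d" "d \<le> 1/9"
    using inverse_power3_le[of 2 "a 1 + 1"] by (auto simp: d_def)
  have "circle_of (1/3 + d) \<in> prepolar (polar (K3 a))"
    unfolding prepolar_def
  proof clarify
    fix \<chi> assume "\<chi> \<in> polar (K3 a)"
    then have \<chi>: "\<chi> \<in> characters" and pl: "\<chi> (xseq a n) \<in> circle_plus" for n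
      by (auto simp: polar_K3_iff)
    obtain t where t: "\<chi> (circle_of (1/3)) = circle_of t" "\<bar>t\<bar> \<le> 1/4"
      using pl[of 0] assms(2) by (auto simp: xseq_def elim: circle_plus_cases)
    have "\<chi> (circle_of 1) = circle_of (3 * t)"
      using character_power3[OF \<chi> t(1), of 1] by simp
    moreover have "circle_of 1 = 0" by (simp add: circle_of_eq_0_iff)
    ultimately have "3 * t \<in> \<int>"
      using character_zero[OF \<chi>] by (metis circle_of_eq_0_iff)
    \<comment> \<open>Here |3 t| <= 3/4, so the integer 3 t is 0.\<close>
    with t(2) have "t = 0" using Ints_nonzero_abs_less1[of "3 * t"] by simp
    then have "\<chi> (circle_of (1/3 + d)) = \<chi> (xseq a 1)"
      using t(1) \<chi> by (simp add: circle_of_add characters_def circle_of_0 xseq_def d_def)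
    then show "\<chi> (circle_of (1/3 + d)) \<in> circle_plus" using pl by simp
  qed
  then have "circle_of (1/3 + d) \<in> K3 a" using qc by (simp add: quasi_convex_def)
  \<comment> \<open>The point 1/3 + d lies in (1/3, 4/9], and moving it by at most 1/3 keeps it
    strictly between 0 and 1.\<close>
  moreover have "1/3 + d \<notin> \<int>" "1/3 + d - 1 / 3 ^ (a n + 1) \<notin> \<int>"
    "1/3 + d + 1 / 3 ^ (a n + 1) \<notin> \<int>" for n
  proof -
    have e: "0 < 1 / (3::real) ^ (a n + 1)" "1 / (3::real) ^ (a n + 1) \<le> 1/3"
      using inverse_power3_le[of 1 "a n + 1"] by auto
    show "1/3 + d \<notin> \<int>" "1/3 + d - 1 / 3 ^ (a n + 1) \<notin> \<int>"
      "1/3 + d + 1 / 3 ^ (a n + 1) \<notin> \<int>"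
      using d e by (intro not_Ints_between_0_1; linarith)+
  qed
  ultimately show False by (auto simp: mem_K3_iff)
qed

lemma not_quasi_convex_if_consecutive:
  assumes "a (Suc n) = Suc (a n)"
  shows "\<not> quasi_convex (K3 a)"
proof
  assume qc: "quasi_convex (K3 a)"
  \<comment> \<open>Since \<open>a (Suc n) + 1 = a n + 2\<close>, the number 1/3^c represents
    \<open>xseq a (Suc n)\<close>; its double is the hull point outside \<open>K3 a\<close>.\<close>
  define c where "c = a n + 2"
  have c: "0 < 1 / (3::real) ^ c" "1 / (3::real) ^ c \<le> 1/9"
    using inverse_power3_le[of 2 c] by (auto simp: c_def)
  have "circle_of (2 / 3 ^ c) \<in> prepolar (polar (K3 a))"
    unfolding prepolar_def
  proof clarify
    fix \<chi> assume "\<chi> \<in> polar (K3 a)"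
    then have \<chi>: "\<chi> \<in> characters" and pl: "\<chi> (xseq a n) \<in> circle_plus" for n
      by (auto simp: polar_K3_iff)
    obtain t where t: "\<chi> (circle_of (1 / 3 ^ c)) = circle_of t" "\<bar>t\<bar> \<le> 1/4"
      using pl[of "Suc n"] assms by (auto simp: xseq_def c_def elim: circle_plus_cases)
    have "\<chi> (xseq a n) = circle_of (3 * t)"
      using character_power3[OF \<chi> t(1), of 1] by (simp add: xseq_def c_def)
    then have "near_int (1/4) (3 * t)"
      using pl[of n] by (simp add: circle_of_mem_plus_iff)
    then obtain m :: int where m: "\<bar>3 * t - of_int m\<bar> \<le> 1/4" by (auto simp: near_int_def)
    have "\<chi> (circle_of 1) = circle_of (3 ^ c * t)"
      using character_power3[OF \<chi> t(1), of c] by simp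
    moreover have "circle_of 1 = 0" by (simp add: circle_of_eq_0_iff)
    ultimately have ord: "3 ^ c * t \<in> \<int>"
      using character_zero[OF \<chi>] by (metis circle_of_eq_0_iff)
    \<comment> \<open>The endpoint needs its own argument: tripling 1/4 gives 3/4, which is again in
      \<open>circle_plus\<close>. It is excluded because 3^c t is an integer while 3^c is
      odd.\<close>
    have "\<bar>t\<bar> \<noteq> 1/4"
    proof
      assume "\<bar>t\<bar> = 1/4"
      then have "t = 1/4 \<or> t = -(1/4)" by linarith
      then have "3 ^ c * (1/4) \<in> (\<int> :: real set)"
        using ord Ints_minus[OF ord] by (elim disjE) simp_all
      then obtain k where "3 ^ c * (1/4) = (of_int k :: real)" by (auto elim: Ints_cases)
      then have "of_int (3 ^ c) = (of_int (4 * k) :: real)" by simp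
      then have "(3::int) ^ c = 4 * k" by (rule of_int_eq_iff[THEN iffD1])
      then have "even ((3::int) ^ c)" by simp
      then show False by simp
    qed
    with t(2) have t': "\<bar>t\<bar> < 1/4" by simp
    \<comment> \<open>Now |m| <= |3 t| + 1/4 < 1, which leaves |3 t| <= 1/4.\<close>
    with m have "\<bar>real_of_int m\<bar> < 1" by linarith
    then have "m = 0" by linarith
    with m have "\<bar>2 * t\<bar> \<le> 1/4" by simp
    then have "circle_of (t + t) \<in> circle_plus"
      unfolding circle_of_mem_plus_iff by (intro near_intI[of _ 0]) simp
    moreover have "\<chi> (circle_of (1 / 3 ^ c + 1 / 3 ^ c)) = circle_of (t + t)"
      using t(1) \<chi> by (simp only: circle_of_add characters_def) simp
    ultimately show "\<chi> (circle_of (2 / 3 ^ c)) \<in> circle_plus"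
      by simp
  qed
  then have "circle_of (2 / 3 ^ c) \<in> K3 a" using qc by (simp add: quasi_convex_def)
  moreover have "2 / 3 ^ c \<notin> (\<int> :: real set)" "2 / 3 ^ c - 1 / 3 ^ (a n + 1) \<notin> (\<int> :: real set)"
    "2 / 3 ^ c + 1 / 3 ^ (a n + 1) \<notin> (\<int> :: real set)" for n
  proof -
    define e where "e = 1 / (3::real) ^ (a n + 1)"
    have e: "0 < e" "e \<le> 1/3"
      using inverse_power3_le[of 1 "a n + 1"] by (auto simp: e_def)
    \<comment> \<open>The difference lies between -1/3 and 2/9, so 0 is the only integer to rule
      out, and parity does this.\<close>
    have ne: "2 / 3 ^ c - e \<noteq> 0"
      using two_mult_power3_neq[of "a n + 1" c] by (simp add: e_def field_simps)
    have "2 / 3 ^ c = 2 * (1 / (3::real) ^ c)" by simp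
    with c have c2: "0 < 2 / (3::real) ^ c" "2 / (3::real) ^ c \<le> 2/9" by linarith+
    have "2 / 3 ^ c - e \<notin> \<int>"
      using Ints_nonzero_abs_less1[of "2 / 3 ^ c - e"] ne c2 e by linarith
    moreover have "2 / 3 ^ c \<notin> (\<int> :: real set)" "2 / 3 ^ c + e \<notin> \<int>"
      using c2 e by (intro not_Ints_between_0_1; linarith)+
    ultimately show "2 / 3 ^ c \<notin> (\<int> :: real set)"
      "2 / 3 ^ c - 1 / 3 ^ (a n + 1) \<notin> (\<int> :: real set)"
      "2 / 3 ^ c + 1 / 3 ^ (a n + 1) \<notin> (\<int> :: real set)"
      by (auto simp: e_def)
  qed
  ultimately show False by (auto simp: mem_K3_iff)
qed

section \<open>Multipliers in the polar\<close>

text \<open>For j < b the value has modulus at most 2/9; for j > b it is an integer. The excluded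
  case j = b gives c/3, too far from the integers unless c = 0.\<close>

lemma near_int_power3_div:
  assumes "j \<noteq> b" "\<bar>c\<bar> \<le> 2"
  shows "near_int (1/4) (of_int (c * 3 ^ j) / 3 ^ (b + 1))"
proof (cases "j < b")
  case True
  then obtain i where i: "b = Suc j + i" using less_imp_Suc_add by force
  have "of_int (c * 3 ^ j) / 3 ^ (b + 1) = of_int c / 9 * (1 / (3::real) ^ i)"
    by (simp add: i power_add)
  moreover have "\<bar>of_int c / 9 * (1 / (3::real) ^ i)\<bar> \<le> 2/9 * 1"
    unfolding abs_mult using assms(2) by (intro mult_mono) auto
  ultimately show ?thesis by (intro near_intI[of _ 0]) linarith
next
  case False
  with assms(1) obtain i where "j = b + 1 + i" using less_imp_Suc_add by force
  then have "of_int (c * 3 ^ j) / 3 ^ (b + 1) = (of_int (c * 3 ^ i) :: real)"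
    by (simp add: power_add)
  then show ?thesis by (intro near_intI[of _ "c * 3 ^ i"]) simp
qed

text \<open>If b < q, the second term is an integer and the first is a single power. If b > q, the
  modulus is at most 2/81 + 2/9 = 20/81 < 1/4. The distance between p and q matters here: q = p + 1
  would allow 2/27 + 2/9 > 1/4.\<close>

lemma near_int_two_powers3_div:
  assumes "p + 2 \<le> q" "\<bar>\<sigma>\<bar> = 1" "b \<noteq> p" "b \<noteq> q"
  shows "near_int (1/4) (of_int (2 * 3 ^ p + 2 * \<sigma> * 3 ^ q) / 3 ^ (b + 1))"
proof (cases "b < q")
  case True
  then obtain i where i: "q = b + 1 + i" using less_imp_Suc_add by force
  have "of_int (2 * 3 ^ p + 2 * \<sigma> * 3 ^ q) / (3::real) ^ (b + 1)
      = of_int (2 * 3 ^ p) / 3 ^ (b + 1) + of_int (2 * \<sigma> * 3 ^ i)"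
    by (simp add: i power_add field_simps)
  then show ?thesis
    using near_int_power3_div[of p b 2] assms(3) by (simp only: near_int_add_int)
next
  case False
  with assms(4) obtain i where i: "b = q + 1 + i" using less_imp_Suc_add[of q b] by auto
  obtain l where l: "q = p + 2 + l" using assms(1) le_Suc_ex by blast
  have eq: "of_int (2 * 3 ^ p + 2 * \<sigma> * 3 ^ q) / (3::real) ^ (b + 1)
      = (2/81 * (1 / 3 ^ l) + 2/9 * of_int \<sigma>) * (1 / 3 ^ i)"
    by (simp add: i l power_add field_simps)
  have \<sigma>: "\<bar>real_of_int \<sigma>\<bar> = 1" using assms(2) by linarith
  have "0 \<le> 1 / (3::real) ^ l" "1 / (3::real) ^ l \<le> 1" by simp_all
  then have "\<bar>2/81 * (1 / 3 ^ l) + 2/9 * real_of_int \<sigma>\<bar> \<le> 1/4" using \<sigma> by linarith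
  then have "\<bar>(2/81 * (1 / 3 ^ l) + 2/9 * real_of_int \<sigma>) * (1 / 3 ^ i)\<bar> \<le> 1/4 * 1"
    unfolding abs_mult by (intro mult_mono) auto
  then show ?thesis unfolding eq by (intro near_intI[of _ 0]) simp
qed

section \<open>Balanced ternary digits and rigidity\<close>

text \<open>Twice the integer near y and the integer near 2 y differ by at most 1/2 + 1/4 < 1, hence
  agree; halving the bound for 2 y gives 1/8.\<close>

lemma near_int_eighth:
  assumes "near_int (1/4) y" "near_int (1/4) (2 * y)"
  shows "near_int (1/8) y"
proof -
  obtain m k :: int where m: "\<bar>y - of_int m\<bar> \<le> 1/4" and k: "\<bar>2 * y - of_int k\<bar> \<le> 1/4"
    using assms by (auto simp: near_int_def)
  then have "\<bar>real_of_int (k - 2 * m)\<bar> < 1"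
    unfolding of_int_diff of_int_mult of_int_numeral by linarith
  then have "k = 2 * m" by linarith
  with k have "\<bar>2 * y - 2 * of_int m\<bar> \<le> 1/4" by simp
  then show ?thesis by (intro near_intI[of _ m]) linarith
qed

text \<open>An error of at most 1/8 triples to at most 3/8, and 3/8 + 1/8 < 1, so the integer near
  the next multiple can only be the triple of the previous one.\<close>

lemma power3_dist_le_eighth:
  assumes "\<And>j. j \<le> i \<Longrightarrow> near_int (1/8) (3 ^ j * y)" "\<bar>y - of_int m\<bar> \<le> 1/8"
  shows "\<bar>3 ^ i * (y - of_int m)\<bar> \<le> 1/8"
  using assms(1)
proof (induction i)
  case 0
  then show ?case using assms(2) by simp
next
  case (Suc i)
  then have IH: "\<bar>3 ^ i * (y - of_int m)\<bar> \<le> 1/8" by simp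
  obtain k :: int where k: "\<bar>3 ^ Suc i * y - of_int k\<bar> \<le> 1/8"
    using Suc.prems[of "Suc i"] by (auto simp: near_int_def)
  have "3 ^ Suc i * (y - of_int m) = 3 ^ Suc i * y - of_int (3 ^ Suc i * m)"
    by (simp add: algebra_simps)
  moreover have "3 ^ Suc i * (y - of_int m) = 3 * (3 ^ i * (y - of_int m))" by simp
  ultimately have "\<bar>real_of_int (3 ^ Suc i * m - k)\<bar> < 1" using IH k
    unfolding of_int_diff by linarith
  then have "3 ^ Suc i * m = k" by linarith
  then show ?case using k by (auto simp: algebra_simps)
qed

lemma Ints_if_power3_near_int:
  assumes "\<And>j. near_int (1/8) (3 ^ j * y)"
  shows "y \<in> \<int>"
proof -
  obtain m :: int where m: "\<bar>y - of_int m\<bar> \<le> 1/8" using assms[of 0] by (auto simp: near_int_def)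
  have "y - of_int m = 0"
  proof (rule ccontr)
    assume ne: "y - of_int m \<noteq> 0"
    \<comment> \<open>A nonzero error would outgrow 1/8 after enough triplings.\<close>
    obtain i where i: "1 / \<bar>y - of_int m\<bar> < 3 ^ i" using real_arch_pow[of 3] by auto
    then have "1 < \<bar>3 ^ i * (y - of_int m)\<bar>"
      using ne unfolding abs_mult by (simp add: divide_less_eq)
    with power3_dist_le_eighth[of i y m] assms m show False by fastforce
  qed
  then show ?thesis by simp
qed

text \<open>The integer \<open>e\<close> is the balanced ternary digit of \<open>y\<close> of weight \<open>3 ^ -(p + 2)\<close>.\<close>

lemma ternary_digit:
  assumes "near_int (1/8) (3 ^ p * y)" "near_int (1/8) (3 ^ Suc (Suc p) * y)"
  obtains m e :: int and v :: real
  where "3 ^ p * y = of_int m + of_int e / 9 + v / 9" "\<bar>e\<bar> \<le> 1" "\<bar>v\<bar> \<le> 1/8"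
    "e = 0 \<Longrightarrow> near_int (1/8) (3 ^ Suc p * y)"
proof -
  obtain m k :: int where m: "\<bar>3 ^ p * y - of_int m\<bar> \<le> 1/8"
    and k: "\<bar>3 ^ Suc (Suc p) * y - of_int k\<bar> \<le> 1/8"
    using assms by (auto simp: near_int_def)
  define e where "e = k - 9 * m"
  define v where "v = 3 ^ Suc (Suc p) * y - of_int k"
  have v: "v = 9 * (3 ^ p * y) - of_int k" by (simp add: v_def)
  have eq: "3 ^ p * y = of_int m + of_int e / 9 + v / 9" by (simp add: v e_def field_simps)
  have vb: "\<bar>v\<bar> \<le> 1/8" using k by (simp add: v_def)
  \<comment> \<open>The bound is 9/8 + 1/8.\<close>
  have "\<bar>real_of_int e\<bar> < 2" using eq m vb by linarith
  then have "\<bar>e\<bar> \<le> 1" by linarith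
  moreover have "near_int (1/8) (3 ^ Suc p * y)" if "e = 0"
  proof (rule near_intI[of _ "3 * m"])
    have "3 ^ Suc p * y = 3 * (3 ^ p * y)" by simp
    also have "\<dots> = 3 * of_int m + v / 3" using eq that by simp
    finally show "\<bar>3 ^ Suc p * y - of_int (3 * m)\<bar> \<le> 1/8" using vb by simp
  qed
  ultimately show ?thesis using that eq vb by blast
qed

text \<open>The sign e f aligns the two digits: e f f = e, so modulo integers the sum is 4 e / 9
  with an error of at most 2/9 * (1/8 + 1/8) = 1/18.\<close>

lemma not_near_int_two_digits:
  assumes "u = of_int m + of_int e / 9 + v / 9" "u' = of_int m' + of_int f / 9 + v' / 9"
    and "\<bar>e\<bar> = 1" "\<bar>f\<bar> = 1" "\<bar>v\<bar> \<le> 1/8" "\<bar>v'\<bar> \<le> 1/8"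
  shows "\<not> near_int (1/4) (2 * u + 2 * of_int (e * f) * u')"
proof
  assume "near_int (1/4) (2 * u + 2 * of_int (e * f) * u')"
  then obtain k :: int where k: "\<bar>2 * u + 2 * of_int (e * f) * u' - of_int k\<bar> \<le> 1/4"
    by (auto simp: near_int_def)
  define z where "z = k - 2 * m - 2 * e * f * m'"
  define w where "w = of_int (e * f) * v'"
  have e: "e = 1 \<or> e = -1" and "f = 1 \<or> f = -1" using assms(3,4) by linarith+
  then have eq: "2 * u + 2 * of_int (e * f) * u' - of_int k
      = 4/9 * of_int e + 2/9 * (v + w) - of_int z"
    unfolding assms(1,2) z_def w_def by (elim disjE) (simp_all add: field_simps)
  have "\<bar>w\<bar> \<le> 1/8"
    using assms(3,4,6) by (simp add: w_def abs_mult flip: of_int_abs)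
  \<comment> \<open>11/36 = 1/4 + 1/18. As 4/9 - 11/36 > 0 and 4/9 + 11/36 < 1, the integer z is
    trapped strictly between 0 and e.\<close>
  with k[unfolded eq] assms(5) have "\<bar>4/9 * real_of_int e - of_int z\<bar> \<le> 11/36"
    unfolding abs_le_iff by argo
  with e have "0 < real_of_int z \<and> real_of_int z < 1 \<or> -1 < real_of_int z \<and> real_of_int z < 0"
    unfolding abs_le_iff by (elim disjE) simp_all
  then show False using Ints_nonzero_abs_less1[of "real_of_int z"] by force
qed

text \<open>\<open>B\<close> stands for the set of values of \<open>a\<close>. The shift to
  \<open>Suc p\<close> in \<open>pair\<close> arises because the digit at place
  \<open>Suc p\<close>, of weight 3^-(p+2), is read off from 3^p y.\<close>

lemma sparse_ternary_rigidity:
  fixes B :: "nat set"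
  assumes "0 \<notin> B" and sparse: "\<And>p. p \<in> B \<Longrightarrow> Suc p \<notin> B"
    and off: "\<And>j. j \<notin> B \<Longrightarrow> near_int (1/8) (3 ^ j * y)"
    and pair: "\<And>p q \<sigma>. Suc p \<in> B \<Longrightarrow> Suc q \<in> B \<Longrightarrow> p < q \<Longrightarrow> \<bar>\<sigma>\<bar> = 1 \<Longrightarrow>
      near_int (1/4) (of_int (2 * 3 ^ p + 2 * \<sigma> * 3 ^ q) * y)"
  shows "y \<in> \<int> \<or> (\<exists>p\<in>B. y - 1 / 3 ^ (p + 1) \<in> \<int> \<or> y + 1 / 3 ^ (p + 1) \<in> \<int>)"
proof -
  \<comment> \<open>The places of nonzero digits. They are positive and both neighbours lie outside
    \<open>B\<close>, so \<open>off\<close> supplies the hypotheses of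
    \<open>ternary_digit\<close>.\<close>
  define S where "S = {p. \<not> near_int (1/8) (3 ^ p * y)}"
  have S: "\<exists>i. p = Suc i \<and> Suc i \<in> B \<and> i \<notin> B \<and> Suc (Suc i) \<notin> B" if "p \<in> S" for p
  proof -
    have "p \<in> B" using that off by (auto simp: S_def)
    with assms(1) sparse show ?thesis by (metis not0_implies_Suc)
  qed
  have digit: "\<exists>(m::int) (e::int) v. 3 ^ i * y = of_int m + of_int e / 9 + v / 9 \<and>
      \<bar>e\<bar> = 1 \<and> \<bar>v\<bar> \<le> 1/8" if i: "Suc i \<in> S" for i
  proof -
    have "i \<notin> B" "Suc (Suc i) \<notin> B" using S[OF i] by auto
    then obtain m e :: int and v :: real
      where *: "3 ^ i * y = of_int m + of_int e / 9 + v / 9" "\<bar>e\<bar> \<le> 1" "\<bar>v\<bar> \<le> 1/8"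
      "e = 0 \<Longrightarrow> near_int (1/8) (3 ^ Suc i * y)"
      using off ternary_digit by metis
    then have "e \<noteq> 0" using i by (auto simp: S_def)
    with *(2) have "\<bar>e\<bar> = 1" by linarith
    with * show ?thesis by blast
  qed
  have uniq: "False" if pq: "p \<in> S" "q \<in> S" "p < q" for p q
  proof -
    obtain i j where ij: "p = Suc i" "q = Suc j" "Suc i \<in> B" "Suc j \<in> B"
      using S pq by metis
    obtain m e :: int and v where 1: "3 ^ i * y = of_int m + of_int e / 9 + v / 9"
      "\<bar>e\<bar> = 1" "\<bar>v\<bar> \<le> 1/8" using digit[of i] pq ij by auto
    obtain m' f :: int and v' where 2: "3 ^ j * y = of_int m' + of_int f / 9 + v' / 9"
      "\<bar>f\<bar> = 1" "\<bar>v'\<bar> \<le> 1/8" using digit[of j] pq ij by auto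
    have "\<bar>e * f\<bar> = 1" using 1 2 by (simp add: abs_mult)
    then have "near_int (1/4) (of_int (2 * 3 ^ i + 2 * (e * f) * 3 ^ j) * y)"
      using pair[of i j "e * f"] ij pq by simp
    moreover have "of_int (2 * 3 ^ i + 2 * (e * f) * 3 ^ j) * y
        = 2 * (3 ^ i * y) + 2 * of_int (e * f) * (3 ^ j * y)"
      by (simp add: algebra_simps)
    ultimately show False
      using not_near_int_two_digits[OF 1(1) 2(1) 1(2) 2(2) 1(3) 2(3)] by simp
  qed
  show ?thesis
  proof (cases "S = {}")
    case True
    then show ?thesis using Ints_if_power3_near_int[of y] by (auto simp: S_def)
  next
    case False
    then obtain i where i: "Suc i \<in> S" "Suc i \<in> B" using S by blast
    have other: "near_int (1/8) (3 ^ j * y)" if "j \<noteq> Suc i" for j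
    proof (rule ccontr)
      assume "\<not> near_int (1/8) (3 ^ j * y)"
      then have "j \<in> S" by (simp add: S_def)
      with uniq i that show False by (metis nat_neq_iff)
    qed
    obtain m :: int where m: "\<bar>y - of_int m\<bar> \<le> 1/8"
      using other[of 0] by (auto simp: near_int_def)
    \<comment> \<open>Powers up to i bound |y - m| by 1/(8 * 3^i); powers from i + 2 on make 3^(i+2)
      y an integer. Hence y - m = M / 3^(i+2) with |M| <= 9/8.\<close>
    have b: "\<bar>3 ^ i * (y - of_int m)\<bar> \<le> 1/8"
      by (rule power3_dist_le_eighth[OF other m]) simp
    have "3 ^ Suc (Suc i) * y \<in> \<int>"
    proof (rule Ints_if_power3_near_int)
      show "near_int (1/8) (3 ^ j * (3 ^ Suc (Suc i) * y))" for j
        using other[of "j + Suc (Suc i)"] by (simp add: power_add mult_ac)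
    qed
    then obtain k :: int where k: "3 ^ Suc (Suc i) * y = of_int k" by (auto elim: Ints_cases)
    define M where "M = k - 3 ^ Suc (Suc i) * m"
    have M: "3 ^ Suc (Suc i) * (y - of_int m) = of_int M"
      by (simp add: M_def algebra_simps k[symmetric])
    have "3 ^ Suc (Suc i) * (y - of_int m) = 9 * (3 ^ i * (y - of_int m))" by simp
    with M b have "\<bar>real_of_int M\<bar> < 2" by linarith
    then have "M = 0 \<or> M = 1 \<or> M = -1" by linarith
    moreover have "y = of_int m + of_int M / 3 ^ (Suc i + 1)"
      using M by (simp add: field_simps)
    ultimately have "y \<in> \<int> \<or> y - 1 / 3 ^ (Suc i + 1) \<in> \<int> \<or> y + 1 / 3 ^ (Suc i + 1) \<in> \<int>"
      by (elim disjE) auto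
    with i(2) show ?thesis by blast
  qed
qed

section \<open>Sufficiency and the equivalence\<close>

text \<open>Rigidity is applied to \<open>range a\<close>; separation is therefore assumed for
  arbitrary pairs of values, not just consecutive ones.\<close>

lemma quasi_convex_if_sparse:
  assumes "0 < a 0" and sep: "\<And>m n. a m < a n \<Longrightarrow> a m + 1 < a n" and "strict_mono a"
  shows "quasi_convex (K3 a)"
proof -
  have "z \<in> K3 a" if z: "z \<in> prepolar (polar (K3 a))" for z
  proof -
    obtain y where y: "z = circle_of y" by (rule circle_of_cases)
    note near = prepolar_polar_K3_near_int[OF z[unfolded y]]
    have "0 < a n" for n
      using assms(1) strict_mono_less_eq[OF assms(3), of 0 n] by simp
    then have "0 \<notin> range a" by (metis less_irrefl rangeE)
    moreover have "Suc p \<notin> range a" if "p \<in> range a" for p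
    proof
      assume "Suc p \<in> range a"
      with that obtain k l where "a k = p" "a l = Suc p" by (metis rangeE)
      with sep[of k l] show False by simp
    qed
    moreover have "near_int (1/8) (3 ^ j * y)" if "j \<notin> range a" for j
    proof (rule near_int_eighth)
      have ne: "j \<noteq> a n" for n using that by auto
      show "near_int (1/4) (3 ^ j * y)"
        using near[of "1 * 3 ^ j"] near_int_power3_div[OF ne, of 1] by simp
      show "near_int (1/4) (2 * (3 ^ j * y))"
        using near[of "2 * 3 ^ j"] near_int_power3_div[OF ne, of 2] by (simp add: mult.assoc)
    qed
    moreover have "near_int (1/4) (of_int (2 * 3 ^ p + 2 * \<sigma> * 3 ^ q) * y)"
      if pq: "Suc p \<in> range a" "Suc q \<in> range a" "p < q" "\<bar>\<sigma>\<bar> = 1" for p q \<sigma>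
    proof (rule near, rule near_int_two_powers3_div)
      fix n
      obtain k l where kl: "a k = Suc p" "a l = Suc q" using pq(1,2) by (metis rangeE)
      \<comment> \<open>Distinct values of \<open>a\<close> differ by at least 2; hence p + 2 <= q,
        and p and q, being predecessors of values, are not values themselves.\<close>
      show "p + 2 \<le> q" using sep[of k l] kl pq(3) by simp
      show "a n \<noteq> p" using sep[of n k] kl by auto
      show "a n \<noteq> q" using sep[of n l] kl by auto
      show "\<bar>\<sigma>\<bar> = 1" by fact
    qed
    ultimately have "y \<in> \<int> \<or>
        (\<exists>p\<in>range a. y - 1 / 3 ^ (p + 1) \<in> \<int> \<or> y + 1 / 3 ^ (p + 1) \<in> \<int>)"
      by (rule sparse_ternary_rigidity)
    then show ?thesis by (auto simp: y mem_K3_iff)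
  qed
  then show ?thesis
    unfolding quasi_convex_def using subset_prepolar_polar by blast
qed

theorem theorem3:
  fixes a :: "nat \<Rightarrow> nat"
  assumes "strict_mono a"
  shows "quasi_convex (K3 a) \<longleftrightarrow> a 0 > 0 \<and> (\<forall>n. gap a n > 1)"
proof
  assume qc: "quasi_convex (K3 a)"
  have "gap a n > 1" for n
  proof (rule ccontr)
    assume "\<not> gap a n > 1"
    moreover have "a n < a (Suc n)" using assms by (simp add: strict_mono_Suc_iff)
    \<comment> \<open>Strict monotonicity leaves 1 as the only possible gap.\<close>
    ultimately have "a (Suc n) = Suc (a n)" by (simp add: gap_def)
    with not_quasi_convex_if_consecutive qc show False by blast
  qed
  with not_quasi_convex_if_start_0[OF assms] qc show "a 0 > 0 \<and> (\<forall>n. gap a n > 1)" by blast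
next
  assume *: "a 0 > 0 \<and> (\<forall>n. gap a n > 1)"
  \<comment> \<open>Monotonicity extends the gap bound from consecutive terms to all pairs.\<close>
  have "a m + 1 < a n" if "a m < a n" for m n
  proof -
    have "Suc m \<le> n" using that assms by (simp add: strict_mono_less)
    then have "a (Suc m) \<le> a n" using assms by (simp add: strict_mono_less_eq)
    moreover have "gap a m > 1" using * by blast
    ultimately show ?thesis by (simp add: gap_def)
  qed
  with * assms show "quasi_convex (K3 a)" by (intro quasi_convex_if_sparse) auto
qed

end
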